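(* Let $\Theta_*\le f_*$ (weak duality), let the optimal value function $\beta$ be lower semicontinuous at the origin, and let $\{(x_n,\mu_n)\}$ be a sequence generated by the asymptotically exact primal-dual method. Suppose that \[ \lim_{n\to\infty}\operatorname{dist}(0,\Phi(x_n))=0,\qquad \liminf_{n\to\infty}\varphi(x_n,\mu_n)\ge0 . \] Then strong duality holds (i.e. $\Theta_*=f_*$), $\lim_{n\to\infty}\varphi(x_n,\mu_n)=0$, and \[ f_*=\lim_{n\to\infty}f(x_n)=\lim_{n\to\infty}F(x_n,\mu_n)=\lim_{n\to\infty}\Theta(\mu_n)=\Theta_* . \] In addition, the following statements hold: (1) if the functions $f$ and $\operatorname{dist}(0,\Phi(\cdot))$ are lower semicontinuous on $Q$ and $\Phi$ takes closed values on $Q$, then any limit point of $\{x_n\}$ (if such a point exists) is a globally optimal solution of problem $(\mathcal{P})$; (2) if $\Theta$ is upper semicontinuous, then any limit point of $\{\mu_n\}$ (if such a point exists) is a globally optimal solution of the dual problem $(\mathcal{D})$.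
   Context: Setting. $(X,d_X)$ is a metric space, $Y$ is a normed space, $Q\subset X$ is a nonempty closed set, $f\colon X\to\mathbb{R}\cup\{+\infty\}$, and $\Phi\colon X\rightrightarrows Y$ is a set-valued map. Problem $(\mathcal{P})$: minimize $f(x)$ subject to $0\in\Phi(x)$, $x\in Q$. Its feasible region is assumed nonempty and its optimal value $f_*$ is assumed finite. $(M,d_M)$ is a metric space, $\varphi\colon X\times M\to(-\infty,+\infty]$ is a given function, and $F(x,\mu)=f(x)+\varphi(x,\mu)$. The dual function is $\Theta(\mu)=\inf_{x\in Q}F(x,\mu)$; the dual problem $(\mathcal{D})$ is to maximize $\Theta(\mu)$ over $\mu\in M$, with optimal value $\Theta_*=\sup_{\mu\in M}\Theta(\mu)$. $\operatorname{dist}(0,\Phi(x))=\inf_{y\in\Phi(x)}\|y\|$ ($=+\infty$ if $\Phi(x)=\emptyset$). The optimal value function is $\beta(y)=\inf\{f(x)\mid x\in Q,\ 0\in\Phi(x)-y\}$, $y\in Y$ (with $\inf\emptyset=+\infty$), so $\beta(0)=f_*$; lower semicontinuity at the origin means $\beta(0)\le\liminf_{y\to0}\beta(y)$. Asymptotically exact primal-dual method: $\{\varepsilon_n\}\subset[0,+\infty)$ is a bounded sequence with $\varepsilon_n\to0$; for each $n\in\mathbb{N}$, $\mu_n\in M$ is chosen arbitrarily and $x_n\in Q$ satisfies $F(x_n,\mu_n)\le F(x,\mu_n)+\varepsilon_n$ for all $x\in Q$. Standing assumption: for every $n$ the function $F(\cdot,\mu_n)$ is bounded below on $Q$. A limit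 point of a sequence is the limit of some convergent subsequence. *)

theory Defs
  imports "HOL-Analysis.Analysis"
begin

section \<open>The primal problem\<close>

definition feasible_set :: "'x set \<Rightarrow> ('x \<Rightarrow> 'y::real_normed_vector set) \<Rightarrow> 'x set" where
  "feasible_set Q \<Phi> = {x \<in> Q. 0 \<in> \<Phi> x}"

definition primal_value ::
  "('x \<Rightarrow> ereal) \<Rightarrow> 'x set \<Rightarrow> ('x \<Rightarrow> 'y::real_normed_vector set) \<Rightarrow> ereal" where
  "primal_value f Q \<Phi> = (INF x \<in> feasible_set Q \<Phi>. f x)"

definition primal_optimal ::
  "('x \<Rightarrow> ereal) \<Rightarrow> 'x set \<Rightarrow> ('x \<Rightarrow> 'y::real_normed_vector set) \<Rightarrow> 'x \<Rightarrow> bool" where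
  "primal_optimal f Q \<Phi> x \<longleftrightarrow>
     x \<in> feasible_set Q \<Phi> \<and> (\<forall>z \<in> feasible_set Q \<Phi>. f x \<le> f z)"

text \<open>The infimum is taken in the extended reals, so the empty set is at distance \<open>\<infinity>\<close>;
  this is why the library's \<open>infdist\<close>, which is \<open>0\<close> on the empty set, is not used.\<close>

definition dist0 :: "'y::real_normed_vector set \<Rightarrow> ereal" where
  "dist0 A = (INF y \<in> A. ereal (norm y))"

definition optimal_value_fun ::
  "('x \<Rightarrow> ereal) \<Rightarrow> 'x set \<Rightarrow> ('x \<Rightarrow> 'y::real_normed_vector set) \<Rightarrow> 'y \<Rightarrow> ereal" where
  "optimal_value_fun f Q \<Phi> y = (INF x \<in> {x \<in> Q. 0 \<in> (\<lambda>z. z - y) ` \<Phi> x}. f x)"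

section \<open>The dual problem\<close>

definition aug_fun :: "('x \<Rightarrow> ereal) \<Rightarrow> ('x \<Rightarrow> 'm \<Rightarrow> ereal) \<Rightarrow> 'x \<Rightarrow> 'm \<Rightarrow> ereal" where
  "aug_fun f \<phi> x \<mu> = f x + \<phi> x \<mu>"

definition dual_fun ::
  "('x \<Rightarrow> ereal) \<Rightarrow> ('x \<Rightarrow> 'm \<Rightarrow> ereal) \<Rightarrow> 'x set \<Rightarrow> 'm \<Rightarrow> ereal" where
  "dual_fun f \<phi> Q \<mu> = (INF x \<in> Q. aug_fun f \<phi> x \<mu>)"

definition dual_value ::
  "('x \<Rightarrow> ereal) \<Rightarrow> ('x \<Rightarrow> 'm \<Rightarrow> ereal) \<Rightarrow> 'x set \<Rightarrow> ereal" where
  "dual_value f \<phi> Q = (SUP \<mu>. dual_fun f \<phi> Q \<mu>)"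

definition dual_optimal ::
  "('x \<Rightarrow> ereal) \<Rightarrow> ('x \<Rightarrow> 'm \<Rightarrow> ereal) \<Rightarrow> 'x set \<Rightarrow> 'm \<Rightarrow> bool" where
  "dual_optimal f \<phi> Q \<mu> \<longleftrightarrow> (\<forall>\<nu>. dual_fun f \<phi> Q \<nu> \<le> dual_fun f \<phi> Q \<mu>)"

section \<open>The asymptotically exact primal-dual method\<close>

definition asymp_exact_method ::
  "('x \<Rightarrow> ereal) \<Rightarrow> ('x \<Rightarrow> 'm \<Rightarrow> ereal) \<Rightarrow> 'x set \<Rightarrow> (nat \<Rightarrow> real) \<Rightarrow> (nat \<Rightarrow> 'x) \<Rightarrow> (nat \<Rightarrow> 'm) \<Rightarrow> bool"
where
  "asymp_exact_method f \<phi> Q \<epsilon> x \<mu> \<longleftrightarrow>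
     (\<forall>n. 0 \<le> \<epsilon> n) \<and> bounded (range \<epsilon>) \<and> \<epsilon> \<longlonglongrightarrow> 0 \<and>
     (\<forall>n. x n \<in> Q \<and> (\<forall>z \<in> Q. aug_fun f \<phi> (x n) (\<mu> n) \<le> aug_fun f \<phi> z (\<mu> n) + ereal (\<epsilon> n)))"

section \<open>Semicontinuity and limit points\<close>

text \<open>The filter \<open>at x within S\<close> excludes \<open>x\<close> itself, which does not affect the inequalities
  below; at isolated points of \<open>S\<close> they hold trivially.\<close>

definition lsc_at_within :: "('a::topological_space \<Rightarrow> ereal) \<Rightarrow> 'a \<Rightarrow> 'a set \<Rightarrow> bool" where
  "lsc_at_within g x S \<longleftrightarrow> g x \<le> Liminf (at x within S) g"

definition lsc_on :: "'a::topological_space set \<Rightarrow> ('a \<Rightarrow> ereal) \<Rightarrow> bool" where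
  "lsc_on S g \<longleftrightarrow> (\<forall>x \<in> S. lsc_at_within g x S)"

definition usc_on :: "'a::topological_space set \<Rightarrow> ('a \<Rightarrow> ereal) \<Rightarrow> bool" where
  "usc_on S g \<longleftrightarrow> (\<forall>x \<in> S. Limsup (at x within S) g \<le> g x)"

text \<open>Limits of convergent subsequences, not accumulation points of the range
  (\<open>islimpt\<close>): a constant sequence has a limit point in this sense.\<close>

definition seq_limit_point :: "(nat \<Rightarrow> 'a::topological_space) \<Rightarrow> 'a \<Rightarrow> bool" where
  "seq_limit_point s l \<longleftrightarrow> (\<exists>r. strict_mono r \<and> (s \<circ> r) \<longlonglongrightarrow> l)"

end

theory Submission
  imports Defs
begin

text \<open>
  The approximate minimality of \<open>x\<^sub>n\<close> and weak duality bound the augmented values from above: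
  \<open>F(x\<^sub>n, \<mu>\<^sub>n) \<le> \<Theta>(\<mu>\<^sub>n) + \<epsilon>\<^sub>n \<le> \<Theta>\<^sub>* + \<epsilon>\<^sub>n \<le> f\<^sub>* + \<epsilon>\<^sub>n\<close>. From below, every \<open>y \<in> \<Phi>(x\<^sub>n)\<close> makes \<open>x\<^sub>n\<close> a
  feasible point of the problem perturbed by \<open>y\<close>, so \<open>f(x\<^sub>n) \<ge> \<beta>(y)\<close>; since \<open>\<Phi>(x\<^sub>n)\<close> contains
  arbitrarily small \<open>y\<close> in the limit, lower semicontinuity of \<open>\<beta>\<close> at the origin gives
  \<open>liminf f(x\<^sub>n) \<ge> \<beta>(0) = f\<^sub>*\<close> (lemma \<open>liminf_objective_ge_primal_value\<close>).

  Thus the two summands of \<open>F(x\<^sub>n, \<mu>\<^sub>n) = f(x\<^sub>n) + \<phi>(x\<^sub>n, \<mu>\<^sub>n)\<close> have lower limits at least \<open>f\<^sub>*\<close> and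
  \<open>0\<close>, while their sum is asymptotically at most \<open>f\<^sub>* + 0\<close>. There is no slack left, and each
  summand must converge to its lower bound (lemma \<open>tendsto_of_liminf_ge_sum_le\<close>). The chain of
  inequalities above then squeezes \<open>\<Theta>(\<mu>\<^sub>n)\<close>, hence also \<open>\<Theta>\<^sub>*\<close>, to \<open>f\<^sub>*\<close>.

  The statements on limit points are the passage to the limit in these relations under
  semicontinuity (lemma \<open>lsc_le_seq_limit\<close>): a limit point \<open>l\<close> of \<open>x\<^sub>n\<close> has \<open>f(l) \<le> f\<^sub>*\<close> and
  \<open>dist(0, \<Phi>(l)) = 0\<close>, and a limit point \<open>\<nu>\<close> of \<open>\<mu>\<^sub>n\<close> has \<open>\<Theta>(\<nu>) \<ge> \<Theta>\<^sub>*\<close>.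
\<close>

lemma lsc_at_eventually_gt:
  assumes "lsc_at_within g l S" and "l \<in> S" and "c < g l"
  shows "\<forall>\<^sub>F z in nhds l. z \<in> S \<longrightarrow> c < g z"
proof -
  have "c < Liminf (at l within S) g"
    using assms(1,3) unfolding lsc_at_within_def by (rule less_le_trans[rotated])
  then have "\<forall>\<^sub>F z in at l within S. c < g z"
    by (rule less_LiminfD)
  then show ?thesis
    \<comment> \<open>The punctured filter says nothing about \<open>l\<close> itself; there the claim is \<open>c < g l\<close>.\<close>
    using assms(3) unfolding eventually_at_filter
    by (auto elim!: eventually_mono)
qed

lemma lsc_le_seq_limit:
  assumes "lsc_at_within g l S" and "l \<in> S" and "\<And>n. s n \<in> S"
    and "s \<longlonglongrightarrow> l" and "(\<lambda>n. g (s n)) \<longlonglongrightarrow> L"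
  shows "g l \<le> L"
proof (rule dense_le)
  fix c assume "c < g l"
  then have "\<forall>\<^sub>F n in sequentially. s n \<in> S \<longrightarrow> c < g (s n)"
    using eventually_compose_filterlim[OF lsc_at_eventually_gt assms(4)] assms(1,2) by blast
  then have "\<forall>\<^sub>F n in sequentially. c \<le> g (s n)"
    by eventually_elim (use assms(3) in auto)
  with assms(5) show "c \<le> L"
    by (rule tendsto_lowerbound) simp
qed

lemma usc_ge_seq_limit:
  fixes g :: "'a::topological_space \<Rightarrow> ereal"
  assumes "usc_on UNIV g" and "s \<longlonglongrightarrow> l" and "(\<lambda>n. g (s n)) \<longlonglongrightarrow> L"
  shows "L \<le> g l"
proof -
  have "lsc_at_within (\<lambda>z. - g z) l UNIV"
    using assms(1) by (simp add: lsc_at_within_def usc_on_def ereal_Liminf_uminus)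
  moreover have "(\<lambda>n. - g (s n)) \<longlonglongrightarrow> - L"
    using assms(3) by (rule tendsto_uminus_ereal)
  ultimately have "- g l \<le> - L"
    using lsc_le_seq_limit[of "\<lambda>z. - g z" l UNIV s "- L"] assms(2) by simp
  then show ?thesis by simp
qed

text \<open>The upper bound on \<open>a n + b n\<close> turns a lower bound for either summand into an upper bound for
  the other, so both limits exist. Excluding \<open>-\<infinity>\<close> lets this bound rule out \<open>\<infinity>\<close> as well, which
  reduces the claim to real sequences.\<close>

lemma tendsto_of_liminf_ge_sum_le:
  fixes a b :: "nat \<Rightarrow> ereal" and A B :: real and e :: "nat \<Rightarrow> real"
  assumes a_fin: "\<And>n. a n \<noteq> -\<infinity>" and b_fin: "\<And>n. b n \<noteq> -\<infinity>"
    and a_ge: "ereal A \<le> liminf a" and b_ge: "ereal B \<le> liminf b"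
    and sum_le: "\<And>n. a n + b n \<le> ereal (A + B + e n)" and e: "e \<longlonglongrightarrow> 0"
  shows "a \<longlonglongrightarrow> ereal A" and "b \<longlonglongrightarrow> ereal B"
proof -
  have "\<exists>p q. a n = ereal p \<and> b n = ereal q" for n
    using a_fin[of n] b_fin[of n] sum_le[of n] by (cases "a n"; cases "b n") auto
  then obtain p q where a: "\<And>n. a n = ereal (p n)" and b: "\<And>n. b n = ereal (q n)"
    by metis
  have pq: "p n + q n \<le> A + B + e n" for n
    using sum_le[of n] by (simp add: a b)
  have near: "\<forall>\<^sub>F n in sequentially. dist (p n) A < d \<and> dist (q n) B < d" if "d > 0" for d
  proof -
    have "ereal (A - d / 2) < liminf a" "ereal (B - d / 2) < liminf b"
      using that by (auto intro: less_le_trans[OF _ a_ge] less_le_trans[OF _ b_ge])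
    then have "\<forall>\<^sub>F n in sequentially. A - d / 2 < p n" "\<forall>\<^sub>F n in sequentially. B - d / 2 < q n"
      by (auto dest!: less_LiminfD simp: a b)
    moreover have "\<forall>\<^sub>F n in sequentially. e n < d / 2"
      using order_tendstoD(2)[OF e, of "d / 2"] that by simp
    ultimately show ?thesis
    proof eventually_elim
      case (elim n)
      then show ?case using pq[of n] by (auto simp: dist_real_def abs_less_iff)
    qed
  qed
  have "p \<longlonglongrightarrow> A" and "q \<longlonglongrightarrow> B"
    by (rule tendstoI, drule near, erule eventually_mono, simp)+
  then show "a \<longlonglongrightarrow> ereal A" and "b \<longlonglongrightarrow> ereal B"
    by (simp_all add: a[abs_def] b[abs_def])
qed

lemma optimal_value_fun_0: "optimal_value_fun f Q \<Phi> 0 = primal_value f Q \<Phi>"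
  by (simp add: optimal_value_fun_def primal_value_def feasible_set_def)

lemma optimal_value_fun_le:
  assumes "z \<in> Q" and "y \<in> \<Phi> z"
  shows "optimal_value_fun f Q \<Phi> y \<le> f z"
  unfolding optimal_value_fun_def by (rule INF_lower) (use assms in force)

text \<open>This is where the perturbed problems enter: an almost feasible \<open>x n\<close> is exactly feasible for
  a perturbation \<open>y\<close> of small norm, and \<open>\<beta>(y)\<close> cannot drop far below \<open>\<beta>(0)\<close>.\<close>

lemma liminf_objective_ge_primal_value:
  assumes lsc: "lsc_at_within (optimal_value_fun f Q \<Phi>) 0 UNIV"
    and Q: "\<And>n. x n \<in> Q"
    and dist: "(\<lambda>n. dist0 (\<Phi> (x n))) \<longlonglongrightarrow> 0"
  shows "primal_value f Q \<Phi> \<le> liminf (\<lambda>n. f (x n))"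
proof (rule dense_le)
  fix c assume "c < primal_value f Q \<Phi>"
  then have "\<forall>\<^sub>F y in nhds 0. c < optimal_value_fun f Q \<Phi> y"
    using lsc_at_eventually_gt[OF lsc, of c] by (simp add: optimal_value_fun_0)
  then obtain d where "d > 0" and d: "\<And>y. norm y < d \<Longrightarrow> c < optimal_value_fun f Q \<Phi> y"
    by (auto simp: eventually_nhds_metric)
  have "\<forall>\<^sub>F n in sequentially. dist0 (\<Phi> (x n)) < ereal d"
    using order_tendstoD(2)[OF dist] \<open>d > 0\<close> by simp
  then have "\<forall>\<^sub>F n in sequentially. c \<le> f (x n)"
  proof eventually_elim
    case (elim n)
    then obtain y where "y \<in> \<Phi> (x n)" "norm y < d"
      by (auto simp: dist0_def INF_less_iff)
    then show ?case
      using d[of y] optimal_value_fun_le[of "x n" Q y \<Phi> f] Q[of n] by force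
  qed
  then show "c \<le> liminf (\<lambda>n. f (x n))"
    by (rule Liminf_bounded)
qed

lemma zero_mem_of_dist0_le_0:
  assumes "closed A" and "dist0 A \<le> 0"
  shows "0 \<in> A"
proof -
  have "\<exists>y\<in>A. dist y 0 < e" if "e > 0" for e
  proof -
    have "dist0 A < ereal e"
      using assms(2) that by (simp add: le_less_trans)
    then show ?thesis
      by (auto simp: dist0_def INF_less_iff)
  qed
  then show ?thesis
    using closure_approachable[of 0 A] assms(1) by simp
qed

lemma aug_fun_le_dual_fun_add:
  assumes "asymp_exact_method f \<phi> Q \<epsilon> x \<mu>"
  shows "aug_fun f \<phi> (x n) (\<mu> n) \<le> dual_fun f \<phi> Q (\<mu> n) + ereal (\<epsilon> n)"
proof -
  have "aug_fun f \<phi> (x n) (\<mu> n) - ereal (\<epsilon> n) \<le> dual_fun f \<phi> Q (\<mu> n)"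
    unfolding dual_fun_def
    by (rule INF_greatest) (use assms in \<open>auto simp: asymp_exact_method_def ereal_minus_le\<close>)
  then show ?thesis
    by (simp add: ereal_minus_le)
qed

lemma dual_fun_le_dual_value: "dual_fun f \<phi> Q \<mu> \<le> dual_value f \<phi> Q"
  unfolding dual_value_def by (rule SUP_upper) simp

text \<open>Lower semicontinuity of \<open>f\<close> gives optimality and that of \<open>dist(0, \<Phi>(\<cdot>))\<close>, with closed values,
  gives feasibility.\<close>

lemma limit_point_primal_optimal:
  fixes x :: "nat \<Rightarrow> 'x::metric_space"
  assumes "closed Q" and Q: "\<And>n. x n \<in> Q"
    and f: "(\<lambda>n. f (x n)) \<longlonglongrightarrow> primal_value f Q \<Phi>"
    and dist: "(\<lambda>n. dist0 (\<Phi> (x n))) \<longlonglongrightarrow> 0"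
    and lsc: "lsc_on Q f" "lsc_on Q (\<lambda>z. dist0 (\<Phi> z))"
    and cl: "\<forall>z\<in>Q. closed (\<Phi> z)"
    and l: "seq_limit_point x l"
  shows "primal_optimal f Q \<Phi> l"
proof -
  obtain r where r: "strict_mono r" and lim: "(\<lambda>n. x (r n)) \<longlonglongrightarrow> l"
    using l by (auto simp: seq_limit_point_def o_def)
  have "l \<in> Q"
    by (rule closed_sequentially[OF \<open>closed Q\<close> _ lim]) (rule Q)
  have mem: "x (r n) \<in> Q" for n
    by (rule Q)
  have "lsc_at_within f l Q"
    using lsc(1) \<open>l \<in> Q\<close> by (simp add: lsc_on_def)
  then have "f l \<le> primal_value f Q \<Phi>"
    using \<open>l \<in> Q\<close> mem lim LIMSEQ_subseq_LIMSEQ[OF f r, unfolded o_def]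
    by (rule lsc_le_seq_limit)
  moreover have "lsc_at_within (\<lambda>z. dist0 (\<Phi> z)) l Q"
    using lsc(2) \<open>l \<in> Q\<close> by (simp add: lsc_on_def)
  then have "dist0 (\<Phi> l) \<le> 0"
    using \<open>l \<in> Q\<close> mem lim LIMSEQ_subseq_LIMSEQ[OF dist r, unfolded o_def]
    by (rule lsc_le_seq_limit)
  ultimately show ?thesis
    using zero_mem_of_dist0_le_0[of "\<Phi> l"] cl \<open>l \<in> Q\<close>
    unfolding primal_optimal_def primal_value_def
    by (auto simp: feasible_set_def le_INF_iff)
qed

lemma limit_point_dual_optimal:
  fixes \<mu> :: "nat \<Rightarrow> 'm::metric_space"
  assumes lim: "(\<lambda>n. dual_fun f \<phi> Q (\<mu> n)) \<longlonglongrightarrow> dual_value f \<phi> Q"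
    and usc: "usc_on UNIV (dual_fun f \<phi> Q)" and \<nu>: "seq_limit_point \<mu> \<nu>"
  shows "dual_optimal f \<phi> Q \<nu>"
proof -
  obtain r where r: "strict_mono r" and \<mu>: "(\<lambda>n. \<mu> (r n)) \<longlonglongrightarrow> \<nu>"
    using \<nu> by (auto simp: seq_limit_point_def o_def)
  have "dual_value f \<phi> Q \<le> dual_fun f \<phi> Q \<nu>"
    using usc_ge_seq_limit[OF usc \<mu>] LIMSEQ_subseq_LIMSEQ[OF lim r] by (simp add: o_def)
  then show ?thesis
    unfolding dual_optimal_def by (blast intro: order_trans[OF dual_fun_le_dual_value])
qed

theorem theorem2:
  fixes f :: "'x::metric_space \<Rightarrow> ereal"
    and Q :: "'x set"
    and \<Phi> :: "'x \<Rightarrow> 'y::real_normed_vector set"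
    and \<phi> :: "'x \<Rightarrow> 'm::metric_space \<Rightarrow> ereal"
    and \<epsilon> :: "nat \<Rightarrow> real"
    and x :: "nat \<Rightarrow> 'x"
    and \<mu> :: "nat \<Rightarrow> 'm"
  assumes "closed Q" and "Q \<noteq> {}"
    and "\<And>z. f z \<noteq> -\<infinity>"
    and "\<And>z \<nu>. \<phi> z \<nu> \<noteq> -\<infinity>"
    and "feasible_set Q \<Phi> \<noteq> {}"
    and "\<bar>primal_value f Q \<Phi>\<bar> \<noteq> \<infinity>"
    and "\<And>n. \<exists>c::real. \<forall>z\<in>Q. ereal c \<le> aug_fun f \<phi> z (\<mu> n)"
    and "dual_value f \<phi> Q \<le> primal_value f Q \<Phi>"
    and "lsc_at_within (optimal_value_fun f Q \<Phi>) 0 UNIV"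
    and "asymp_exact_method f \<phi> Q \<epsilon> x \<mu>"
    and "(\<lambda>n. dist0 (\<Phi> (x n))) \<longlonglongrightarrow> 0"
    and "0 \<le> liminf (\<lambda>n. \<phi> (x n) (\<mu> n))"
  shows "dual_value f \<phi> Q = primal_value f Q \<Phi>
    \<and> (\<lambda>n. \<phi> (x n) (\<mu> n)) \<longlonglongrightarrow> 0
    \<and> (\<lambda>n. f (x n)) \<longlonglongrightarrow> primal_value f Q \<Phi>
    \<and> (\<lambda>n. aug_fun f \<phi> (x n) (\<mu> n)) \<longlonglongrightarrow> primal_value f Q \<Phi>
    \<and> (\<lambda>n. dual_fun f \<phi> Q (\<mu> n)) \<longlonglongrightarrow> primal_value f Q \<Phi>
    \<and> (lsc_on Q f \<and> lsc_on Q (\<lambda>z. dist0 (\<Phi> z)) \<and> (\<forall>z\<in>Q. closed (\<Phi> z))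
         \<longrightarrow> (\<forall>l. seq_limit_point x l \<longrightarrow> primal_optimal f Q \<Phi> l))
    \<and> (usc_on UNIV (dual_fun f \<phi> Q)
         \<longrightarrow> (\<forall>\<nu>. seq_limit_point \<mu> \<nu> \<longrightarrow> dual_optimal f \<phi> Q \<nu>))"
proof -
  obtain A where A: "primal_value f Q \<Phi> = ereal A"
    using assms(6) by (cases "primal_value f Q \<Phi>") auto
  note exact = assms(10)
  have Q: "\<And>n. x n \<in> Q" and \<epsilon>: "\<epsilon> \<longlonglongrightarrow> 0"
    using exact by (auto simp: asymp_exact_method_def)
  have dual_le: "dual_fun f \<phi> Q (\<mu> n) \<le> ereal A" for n
    using order_trans[OF dual_fun_le_dual_value assms(8)] by (simp add: A)
  have "aug_fun f \<phi> (x n) (\<mu> n) \<le> ereal A + ereal (\<epsilon> n)" for n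
    by (rule order_trans[OF aug_fun_le_dual_fun_add[OF exact] add_right_mono[OF dual_le]])
  then have sum_le: "f (x n) + \<phi> (x n) (\<mu> n) \<le> ereal (A + 0 + \<epsilon> n)" for n
    by (simp add: aug_fun_def)
  have f_ge: "ereal A \<le> liminf (\<lambda>n. f (x n))"
    using liminf_objective_ge_primal_value[OF assms(9) Q assms(11)] by (simp add: A)
  have \<phi>_ge: "ereal 0 \<le> liminf (\<lambda>n. \<phi> (x n) (\<mu> n))"
    using assms(12) by (simp add: zero_ereal_def)
  note lims = tendsto_of_liminf_ge_sum_le[where a = "\<lambda>n. f (x n)" and b = "\<lambda>n. \<phi> (x n) (\<mu> n)",
      OF assms(3) assms(4) f_ge \<phi>_ge sum_le \<epsilon>]
  have f_lim: "(\<lambda>n. f (x n)) \<longlonglongrightarrow> primal_value f Q \<Phi>"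
    using lims(1) by (simp add: A)
  have \<phi>_lim: "(\<lambda>n. \<phi> (x n) (\<mu> n)) \<longlonglongrightarrow> 0"
    using lims(2) by (simp add: zero_ereal_def)
  have F_lim: "(\<lambda>n. aug_fun f \<phi> (x n) (\<mu> n)) \<longlonglongrightarrow> ereal A"
    using tendsto_add_ereal[OF _ _ lims] by (simp add: aug_fun_def zero_ereal_def)
  have "(\<lambda>n. aug_fun f \<phi> (x n) (\<mu> n) - ereal (\<epsilon> n)) \<longlonglongrightarrow> ereal A - ereal 0"
    by (rule tendsto_diff_ereal[OF _ _ F_lim]) (use \<epsilon> in auto)
  then have lower_lim: "(\<lambda>n. aug_fun f \<phi> (x n) (\<mu> n) - ereal (\<epsilon> n)) \<longlonglongrightarrow> ereal A"
    by simp
  have dual_lim: "(\<lambda>n. dual_fun f \<phi> Q (\<mu> n)) \<longlonglongrightarrow> ereal A"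
    by (rule tendsto_sandwich[OF _ _ lower_lim tendsto_const])
      (simp_all add: ereal_minus_le aug_fun_le_dual_fun_add[OF exact] dual_le)
  have "ereal A \<le> dual_value f \<phi> Q"
    by (rule LIMSEQ_le_const2[OF dual_lim]) (simp add: dual_fun_le_dual_value)
  then have strong: "dual_value f \<phi> Q = primal_value f Q \<Phi>"
    using assms(8) by (simp add: A)
  show ?thesis
  proof (intro conjI impI allI)
    fix l
    assume "lsc_on Q f \<and> lsc_on Q (\<lambda>z. dist0 (\<Phi> z)) \<and> (\<forall>z\<in>Q. closed (\<Phi> z))"
      and "seq_limit_point x l"
    then show "primal_optimal f Q \<Phi> l"
      using limit_point_primal_optimal[OF assms(1) Q f_lim assms(11)] by blast
  next
    fix \<nu>
    assume "usc_on UNIV (dual_fun f \<phi> Q)" and "seq_limit_point \<mu> \<nu>"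
    then show "dual_optimal f \<phi> Q \<nu>"
      using limit_point_dual_optimal[OF dual_lim[folded A, folded strong]] by blast
  qed (use strong \<phi>_lim f_lim F_lim dual_lim in \<open>simp_all add: A\<close>)
qed

end
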